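(* Let $h(T)$ be a polynomial with integer coefficients with $h(1)=0$, let $X=\mathbf{Z}[T,T^{-1}]/(h(T))$ be the Alexander quandle with operation $a*b=Ta+(1-T)b$, let $T_\infty=\mathbf{Z}$ be regarded as a trivial quandle ($x*y=x$), and let $\pi:X\to T_\infty$ be the quandle homomorphism defined by $\pi(f(T))=f(1)$. Then the induced homomorphisms $\pi_*:H_2^{\rm Q}(X)\to H_2^{\rm Q}(T_\infty)$ and $\pi^*:H^2_{\rm Q}(T_\infty)\to H^2_{\rm Q}(X)$ (with coefficients $\mathbf{Z}$) are not $0$-maps. In particular $H_2^{\rm Q}(X)\ne0$ and $H^2_{\rm Q}(X)\neq 0$.
   Context: A quandle is a set $X$ with a binary operation $*$ such that (I) $a*a=a$; (II) for all $a,b$ there is a unique $c$ with $a=c*b$; (III) $(a*b)*c=(a*c)*(b*c)$. Quandle homomorphisms are maps preserving $*$. Quandle (co)homology: for $n\ge1$, $C_n^{\rm R}(X)$ is the free abelian group on $n$-tuples $(x_1,\dots,x_n)\in X^n$, $C_n^{\rm R}(X)=0$ for $n\le0$; for $n\ge2$ $$\partial_n(x_1,\dots,x_n)=\sum_{i=2}^n(-1)^i\big[(x_1,\dots,x_{i-1},x_{i+1},\dots,x_n)-(x_1*x_i,\dots,x_{i-1}*x_i,x_{i+1},\dots,x_n)\big],$$ and $\partial_n=0$ for $n\le1$. $C_n^{\rm D}(X)$ is the subgroup generated by tuples with $x_i=x_{i+1}$ for some $i$ (zero for $n\le1$), a subcomplex; $C_n^{\rm Q}(X)=C_n^{\rm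 R}(X)/C_n^{\rm D}(X)$ with induced boundary. $H_n^{\rm Q}(X)=H_n(C_*^{\rm Q}(X))$ and $H^n_{\rm Q}(X)=H^n(\mathrm{Hom}(C_*^{\rm Q}(X),\mathbf{Z}))$. A quandle homomorphism $f$ induces $f_*$ and $f^*$ via $(x_1,\dots,x_n)\mapsto(f(x_1),\dots,f(x_n))$. *)

theory Defs
  imports "HOL-Algebra.Algebra" "HOL-Algebra.Algebraic_Closure_Type"
    "HOL-Computational_Algebra.Polynomial"
begin

section \<open>Quandles\<close>

record 'a quandle = "'a partial_object" +
  qop :: "'a \<Rightarrow> 'a \<Rightarrow> 'a" (infixl \<open>\<triangleright>\<index>\<close> 70)

locale quandle =
  fixes Q :: "('a, 'm) quandle_scheme" (structure)
  assumes closed: "\<lbrakk>a \<in> carrier Q; b \<in> carrier Q\<rbrakk> \<Longrightarrow> a \<triangleright> b \<in> carrier Q"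
    and idem: "a \<in> carrier Q \<Longrightarrow> a \<triangleright> a = a"
    and right_inv: "\<lbrakk>a \<in> carrier Q; b \<in> carrier Q\<rbrakk> \<Longrightarrow> \<exists>!c. c \<in> carrier Q \<and> a = c \<triangleright> b"
    and distrib: "\<lbrakk>a \<in> carrier Q; b \<in> carrier Q; c \<in> carrier Q\<rbrakk>
      \<Longrightarrow> (a \<triangleright> b) \<triangleright> c = (a \<triangleright> c) \<triangleright> (b \<triangleright> c)"

definition quandle_hom :: "('a, 'm) quandle_scheme \<Rightarrow> ('b, 'n) quandle_scheme \<Rightarrow> ('a \<Rightarrow> 'b) set"
  where "quandle_hom Q Q' = {f \<in> carrier Q \<rightarrow> carrier Q'.
    \<forall>a\<in>carrier Q. \<forall>b\<in>carrier Q. f (a \<triangleright>\<^bsub>Q\<^esub> b) = f a \<triangleright>\<^bsub>Q'\<^esub> f b}"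

section \<open>Homology and cohomology of a complex of abelian groups\<close>

text \<open>A complex is a family of groups \<open>C n\<close> (in multiplicative \<open>HOL-Algebra\<close> notation),
  \<open>n :: int\<close>, with differentials \<open>d n\<close> from \<open>C n\<close> to \<open>C (n - 1)\<close>.\<close>

definition homology_group ::
    "(int \<Rightarrow> 'c monoid) \<Rightarrow> (int \<Rightarrow> 'c \<Rightarrow> 'c) \<Rightarrow> int \<Rightarrow> 'c set monoid"
  where "homology_group C d n =
    (C n)\<lparr>carrier := kernel (C n) (C (n - 1)) (d n)\<rparr> Mod (d (n + 1) ` carrier (C (n + 1)))"

text \<open>The map induced on \<open>n\<close>-th homology by \<open>f\<close>, the degree \<open>n\<close> part of a chain map into
  \<open>(C, d)\<close>: the class of \<open>z\<close> goes to the class of \<open>f z\<close>.\<close>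

definition homology_map ::
    "(int \<Rightarrow> 'c monoid) \<Rightarrow> (int \<Rightarrow> 'c \<Rightarrow> 'c) \<Rightarrow> int \<Rightarrow> ('b \<Rightarrow> 'c) \<Rightarrow> 'b set \<Rightarrow> 'c set"
  where "homology_map C d n f u =
    the_elem ((\<lambda>z. (d (n + 1) ` carrier (C (n + 1))) #>\<^bsub>C n\<^esub> f z) ` u)"

text \<open>Homomorphisms are taken extensional, i.e. \<open>undefined\<close> off the carrier, so that they are
  equal iff they agree on the carrier.\<close>

definition Hom_group :: "('c, 'm) monoid_scheme \<Rightarrow> ('d, 'n) monoid_scheme \<Rightarrow> ('c \<Rightarrow> 'd) monoid"
  where "Hom_group G H =
    \<lparr>carrier = hom G H \<inter> extensional (carrier G),
     monoid.mult = (\<lambda>f g. \<lambda>x\<in>carrier G. f x \<otimes>\<^bsub>H\<^esub> g x),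
     one = (\<lambda>x\<in>carrier G. \<one>\<^bsub>H\<^esub>)\<rparr>"

definition cochain_group :: "(int \<Rightarrow> 'c monoid) \<Rightarrow> int \<Rightarrow> ('c \<Rightarrow> int) monoid"
  where "cochain_group C n = Hom_group (C n) integer_group"

definition coboundary ::
    "(int \<Rightarrow> 'c monoid) \<Rightarrow> (int \<Rightarrow> 'c \<Rightarrow> 'c) \<Rightarrow> int \<Rightarrow> ('c \<Rightarrow> int) \<Rightarrow> 'c \<Rightarrow> int"
  where "coboundary C d n \<phi> = compose (carrier (C (n + 1))) \<phi> (d (n + 1))"

definition cohomology_group ::
    "(int \<Rightarrow> 'c monoid) \<Rightarrow> (int \<Rightarrow> 'c \<Rightarrow> 'c) \<Rightarrow> int \<Rightarrow> ('c \<Rightarrow> int) set monoid"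
  where "cohomology_group C d n =
    (cochain_group C n)
      \<lparr>carrier := kernel (cochain_group C n) (cochain_group C (n + 1)) (coboundary C d n)\<rparr>
    Mod (coboundary C d (n - 1) ` carrier (cochain_group C (n - 1)))"

text \<open>The map induced on \<open>n\<close>-th cohomology by \<open>f\<close>, the degree \<open>n\<close> part of a chain map out of
  \<open>(C, d)\<close>: the class of \<open>\<phi>\<close> goes to the class of \<open>\<phi> \<circ> f\<close> in the cohomology of \<open>(C, d)\<close>.\<close>

definition cohomology_map ::
    "(int \<Rightarrow> 'c monoid) \<Rightarrow> (int \<Rightarrow> 'c \<Rightarrow> 'c) \<Rightarrow> int \<Rightarrow> ('c \<Rightarrow> 'b) \<Rightarrow> ('b \<Rightarrow> int) set \<Rightarrow> ('c \<Rightarrow> int) set"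
  where "cohomology_map C d n f u =
    the_elem ((\<lambda>\<phi>. (coboundary C d (n - 1) ` carrier (cochain_group C (n - 1)))
      #>\<^bsub>cochain_group C n\<^esub> compose (carrier (C n)) \<phi> f) ` u)"

section \<open>The quandle complex\<close>

definition tuples :: "('a, 'm) quandle_scheme \<Rightarrow> int \<Rightarrow> 'a list set"
  where "tuples Q n = {xs. 1 \<le> n \<and> int (length xs) = n \<and> set xs \<subseteq> carrier Q}"

definition rack_chains :: "('a, 'm) quandle_scheme \<Rightarrow> int \<Rightarrow> ('a list \<Rightarrow>\<^sub>0 int) monoid"
  where "rack_chains Q n = free_Abelian_group (tuples Q n)"

text \<open>Lists are indexed from 0, so the entry \<open>x\<^sub>i\<close> of \<open>(x\<^sub>1, \<dots>, x\<^sub>n)\<close> is \<open>xs ! (i - 1)\<close>, and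
  \<open>x\<^sub>1, \<dots>, x\<^sub>i\<^sub>-\<^sub>1\<close> is \<open>take (i - 1) xs\<close>, and \<open>x\<^sub>i\<^sub>+\<^sub>1, \<dots>, x\<^sub>n\<close> is \<open>drop i xs\<close>.
  The degree is the length of the list; for length at most 1 the sum is empty.\<close>

definition rack_boundary ::
    "('a, 'm) quandle_scheme \<Rightarrow> ('a list \<Rightarrow>\<^sub>0 int) \<Rightarrow> ('a list \<Rightarrow>\<^sub>0 int)"
  where "rack_boundary Q = frag_extend (\<lambda>xs. \<Sum>i = 2..length xs. frag_cmul ((-1) ^ i)
    (frag_of (take (i - 1) xs @ drop i xs)
     - frag_of (map (\<lambda>y. y \<triangleright>\<^bsub>Q\<^esub> (xs ! (i - 1))) (take (i - 1) xs) @ drop i xs)))"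

definition degenerate_chains :: "('a, 'm) quandle_scheme \<Rightarrow> int \<Rightarrow> ('a list \<Rightarrow>\<^sub>0 int) set"
  where "degenerate_chains Q n = generate (rack_chains Q n)
    (frag_of ` {xs \<in> tuples Q n. \<exists>i. Suc i < length xs \<and> xs ! i = xs ! Suc i})"

definition quandle_chains :: "('a, 'm) quandle_scheme \<Rightarrow> int \<Rightarrow> ('a list \<Rightarrow>\<^sub>0 int) set monoid"
  where "quandle_chains Q n = rack_chains Q n Mod degenerate_chains Q n"

definition quandle_boundary ::
    "('a, 'm) quandle_scheme \<Rightarrow> int \<Rightarrow> ('a list \<Rightarrow>\<^sub>0 int) set \<Rightarrow> ('a list \<Rightarrow>\<^sub>0 int) set"
  where "quandle_boundary Q n U =
    the_elem ((\<lambda>c. degenerate_chains Q (n - 1) #>\<^bsub>rack_chains Q (n - 1)\<^esub> rack_boundary Q c) ` U)"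

text \<open>The chain map induced by \<open>f\<close>; here \<open>Q'\<close> is the target quandle.\<close>

definition quandle_chain_map ::
    "('b, 'n) quandle_scheme \<Rightarrow> ('a \<Rightarrow> 'b) \<Rightarrow> int \<Rightarrow> ('a list \<Rightarrow>\<^sub>0 int) set \<Rightarrow> ('b list \<Rightarrow>\<^sub>0 int) set"
  where "quandle_chain_map Q' f n U =
    the_elem ((\<lambda>c. degenerate_chains Q' n #>\<^bsub>rack_chains Q' n\<^esub>
      frag_extend (\<lambda>xs. frag_of (map f xs)) c) ` U)"

definition quandle_homology ::
    "int \<Rightarrow> ('a, 'm) quandle_scheme \<Rightarrow> ('a list \<Rightarrow>\<^sub>0 int) set set monoid"
  where "quandle_homology n Q = homology_group (quandle_chains Q) (quandle_boundary Q) n"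

definition quandle_cohomology ::
    "int \<Rightarrow> ('a, 'm) quandle_scheme \<Rightarrow> (('a list \<Rightarrow>\<^sub>0 int) set \<Rightarrow> int) set monoid"
  where "quandle_cohomology n Q = cohomology_group (quandle_chains Q) (quandle_boundary Q) n"

definition quandle_homology_map ::
    "int \<Rightarrow> ('a, 'm) quandle_scheme \<Rightarrow> ('b, 'n) quandle_scheme \<Rightarrow> ('a \<Rightarrow> 'b) \<Rightarrow>
     ('a list \<Rightarrow>\<^sub>0 int) set set \<Rightarrow> ('b list \<Rightarrow>\<^sub>0 int) set set"
  where "quandle_homology_map n Q Q' f =
    homology_map (quandle_chains Q') (quandle_boundary Q') n (quandle_chain_map Q' f n)"

definition quandle_cohomology_map ::
    "int \<Rightarrow> ('a, 'm) quandle_scheme \<Rightarrow> ('b, 'n) quandle_scheme \<Rightarrow> ('a \<Rightarrow> 'b) \<Rightarrow>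
     (('b list \<Rightarrow>\<^sub>0 int) set \<Rightarrow> int) set \<Rightarrow> (('a list \<Rightarrow>\<^sub>0 int) set \<Rightarrow> int) set"
  where "quandle_cohomology_map n Q Q' f =
    cohomology_map (quandle_chains Q) (quandle_boundary Q) n (quandle_chain_map Q' f n)"

section \<open>The Alexander quandle of a polynomial\<close>

text \<open>The ring of Laurent polynomials over the integers is the group ring of the additive group
  \<open>int\<close>: the coefficient of \<open>T\<close> to the power \<open>k\<close> in \<open>p\<close> is \<open>lookup p k\<close>, and multiplication
  on \<open>\<Rightarrow>\<^sub>0\<close> is convolution.\<close>

type_synonym laurent = "int \<Rightarrow>\<^sub>0 int"

definition laurent_T :: laurent
  where "laurent_T = Poly_Mapping.single 1 1"

definition laurent_ring :: "laurent ring"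
  where "laurent_ring = ring_of_type_algebra"

definition laurent_of_poly :: "int poly \<Rightarrow> laurent"
  where "laurent_of_poly h = poly (map_poly of_int h) laurent_T"

definition laurent_at_one :: "laurent \<Rightarrow> int"
  where "laurent_at_one p = (\<Sum>k\<in>Poly_Mapping.keys p. Poly_Mapping.lookup p k)"

definition poly_ideal :: "int poly \<Rightarrow> laurent set"
  where "poly_ideal h = PIdl\<^bsub>laurent_ring\<^esub> (laurent_of_poly h)"

definition alexander_quandle :: "('r, 'm) ring_scheme \<Rightarrow> 'r \<Rightarrow> 'r quandle"
  where "alexander_quandle R t =
    \<lparr>carrier = carrier R,
     qop = (\<lambda>a b. (t \<otimes>\<^bsub>R\<^esub> a) \<oplus>\<^bsub>R\<^esub> ((\<one>\<^bsub>R\<^esub> \<ominus>\<^bsub>R\<^esub> t) \<otimes>\<^bsub>R\<^esub> b))\<rparr>"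

definition alexander_quandle_of :: "int poly \<Rightarrow> laurent set quandle"
  where "alexander_quandle_of h =
    alexander_quandle (laurent_ring Quot poly_ideal h) (poly_ideal h +>\<^bsub>laurent_ring\<^esub> laurent_T)"

definition T_infinity :: "int quandle"
  where "T_infinity = \<lparr>carrier = UNIV, qop = (\<lambda>x y. x)\<rparr>"

text \<open>Elements of the quotient are cosets, on which evaluation at 1 is constant if \<open>h(1) = 0\<close>.\<close>

definition eval_one :: "laurent set \<Rightarrow> int"
  where "eval_one A = the_elem (laurent_at_one ` A)"

section \<open>The objects above are quandles, and evaluation at 1 is a homomorphism\<close>

lemma quandle_T_infinity: "quandle T_infinity"
  by unfold_locales (auto simp: T_infinity_def)

lemma quandle_alexander_quandle:
  assumes "cring R" and t: "t \<in> Units R"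
  shows "quandle (alexander_quandle R t)"
proof -
  interpret cring R by fact
  have tc [simp]: "t \<in> carrier R" using t by blast
  define s where "s = inv\<^bsub>R\<^esub> t"
  have sc [simp]: "s \<in> carrier R" and st: "t \<otimes>\<^bsub>R\<^esub> s = \<one>\<^bsub>R\<^esub>" "s \<otimes>\<^bsub>R\<^esub> t = \<one>\<^bsub>R\<^esub>"
    using t by (auto simp: s_def)
  define op where "op = (\<lambda>a b. (t \<otimes>\<^bsub>R\<^esub> a) \<oplus>\<^bsub>R\<^esub> ((\<one>\<^bsub>R\<^esub> \<ominus>\<^bsub>R\<^esub> t) \<otimes>\<^bsub>R\<^esub> b))"
  have X: "alexander_quandle R t = \<lparr>carrier = carrier R, qop = op\<rparr>"
    by (simp add: alexander_quandle_def op_def)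
  have idem: "op a a = a" if "a \<in> carrier R" for a
    using that tc unfolding op_def by algebra
  have ex: "\<exists>!c. c \<in> carrier R \<and> a = op c b" if ab: "a \<in> carrier R" "b \<in> carrier R" for a b
  proof (rule ex1I)
    let ?c = "s \<otimes>\<^bsub>R\<^esub> (a \<ominus>\<^bsub>R\<^esub> (\<one>\<^bsub>R\<^esub> \<ominus>\<^bsub>R\<^esub> t) \<otimes>\<^bsub>R\<^esub> b)"
    have "op ?c b = (t \<otimes>\<^bsub>R\<^esub> s) \<otimes>\<^bsub>R\<^esub> (a \<ominus>\<^bsub>R\<^esub> (\<one>\<^bsub>R\<^esub> \<ominus>\<^bsub>R\<^esub> t) \<otimes>\<^bsub>R\<^esub> b) \<oplus>\<^bsub>R\<^esub> (\<one>\<^bsub>R\<^esub> \<ominus>\<^bsub>R\<^esub> t) \<otimes>\<^bsub>R\<^esub> b"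
      using ab by (simp add: op_def m_assoc)
    also have "\<dots> = a"
      using ab by (simp add: st a_minus_def a_assoc l_neg)
    finally show "?c \<in> carrier R \<and> a = op ?c b"
      using ab by simp
  next
    fix c assume c: "c \<in> carrier R \<and> a = op c b"
    then have cc: "c \<in> carrier R" and a: "a = op c b" by auto
    have "op c b \<ominus>\<^bsub>R\<^esub> (\<one>\<^bsub>R\<^esub> \<ominus>\<^bsub>R\<^esub> t) \<otimes>\<^bsub>R\<^esub> b = t \<otimes>\<^bsub>R\<^esub> c"
      using cc ab(2) unfolding op_def by (simp add: a_minus_def a_assoc r_neg)
    then have "a \<ominus>\<^bsub>R\<^esub> (\<one>\<^bsub>R\<^esub> \<ominus>\<^bsub>R\<^esub> t) \<otimes>\<^bsub>R\<^esub> b = t \<otimes>\<^bsub>R\<^esub> c"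
      by (simp only: a)
    then show "c = s \<otimes>\<^bsub>R\<^esub> (a \<ominus>\<^bsub>R\<^esub> (\<one>\<^bsub>R\<^esub> \<ominus>\<^bsub>R\<^esub> t) \<otimes>\<^bsub>R\<^esub> b)"
      using cc st by (simp flip: m_assoc)
  qed
  have dist: "op (op a b) c = op (op a c) (op b c)"
    if abc [simp]: "a \<in> carrier R" "b \<in> carrier R" "c \<in> carrier R" for a b c
  proof -
    define u where "u = \<one>\<^bsub>R\<^esub> \<ominus>\<^bsub>R\<^esub> t"
    have u [simp]: "u \<in> carrier R" by (simp add: u_def)
    have "t \<oplus>\<^bsub>R\<^esub> u = \<one>\<^bsub>R\<^esub>" using tc unfolding u_def by algebra
    then have "u \<otimes>\<^bsub>R\<^esub> c = (t \<oplus>\<^bsub>R\<^esub> u) \<otimes>\<^bsub>R\<^esub> (u \<otimes>\<^bsub>R\<^esub> c)" by simp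
    then have uc: "u \<otimes>\<^bsub>R\<^esub> c = t \<otimes>\<^bsub>R\<^esub> (u \<otimes>\<^bsub>R\<^esub> c) \<oplus>\<^bsub>R\<^esub> u \<otimes>\<^bsub>R\<^esub> (u \<otimes>\<^bsub>R\<^esub> c)"
      by (simp add: l_distr)
    have "op (op a b) c = t \<otimes>\<^bsub>R\<^esub> (t \<otimes>\<^bsub>R\<^esub> a \<oplus>\<^bsub>R\<^esub> u \<otimes>\<^bsub>R\<^esub> b)
        \<oplus>\<^bsub>R\<^esub> (t \<otimes>\<^bsub>R\<^esub> (u \<otimes>\<^bsub>R\<^esub> c) \<oplus>\<^bsub>R\<^esub> u \<otimes>\<^bsub>R\<^esub> (u \<otimes>\<^bsub>R\<^esub> c))"
      unfolding op_def u_def[symmetric] by (simp only: uc[symmetric])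
    also have "\<dots> = op (op a c) (op b c)"
      unfolding op_def u_def[symmetric] by (simp add: r_distr a_ac m_lcomm)
    finally show ?thesis .
  qed
  have "op a b \<in> carrier R" if "a \<in> carrier R" "b \<in> carrier R" for a b
    using that by (simp add: op_def)
  then show ?thesis
    unfolding X quandle_def partial_object.simps quandle.simps
    using idem ex dist by blast
qed

lemma cring_laurent_ring: "cring laurent_ring"
  unfolding laurent_ring_def by (rule cring_from_type_algebra)

lemma laurent_ring_simps [simp]:
  "carrier laurent_ring = UNIV" "\<one>\<^bsub>laurent_ring\<^esub> = 1" "\<zero>\<^bsub>laurent_ring\<^esub> = 0"
  "a \<otimes>\<^bsub>laurent_ring\<^esub> b = a * b" "a \<oplus>\<^bsub>laurent_ring\<^esub> b = a + b"
  by (simp_all add: laurent_ring_def ring_of_type_algebra_def)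

lemma laurent_ring_uminus [simp]: "\<ominus>\<^bsub>laurent_ring\<^esub> b = - b"
proof -
  interpret cring laurent_ring by (rule cring_laurent_ring)
  show ?thesis by (rule minus_equality) auto
qed

lemma ideal_poly_ideal: "ideal (poly_ideal h) laurent_ring"
  unfolding poly_ideal_def by (rule cring.cgenideal_ideal[OF cring_laurent_ring]) simp

lemma cring_poly_quotient: "cring (laurent_ring Quot poly_ideal h)"
  by (rule ideal.quotient_is_cring[OF ideal_poly_ideal cring_laurent_ring])

lemma laurent_T_coset_unit:
  "poly_ideal h +>\<^bsub>laurent_ring\<^esub> laurent_T \<in> Units (laurent_ring Quot poly_ideal h)"
proof -
  interpret ring_hom_ring laurent_ring "laurent_ring Quot poly_ideal h" "(+>\<^bsub>laurent_ring\<^esub>) (poly_ideal h)"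
    by (rule ideal.rcos_ring_hom_ring[OF ideal_poly_ideal])
  let ?T' = "Poly_Mapping.single (-1) 1 :: laurent"
  have "laurent_T * ?T' = 1"
    by (simp add: laurent_T_def mult_single)
  then have "laurent_T * ?T' = 1" "?T' * laurent_T = 1"
    by (simp_all add: mult.commute)
  then have "(poly_ideal h +>\<^bsub>laurent_ring\<^esub> laurent_T) \<otimes>\<^bsub>laurent_ring Quot poly_ideal h\<^esub>
      (poly_ideal h +>\<^bsub>laurent_ring\<^esub> ?T') = \<one>\<^bsub>laurent_ring Quot poly_ideal h\<^esub>"
    "(poly_ideal h +>\<^bsub>laurent_ring\<^esub> ?T') \<otimes>\<^bsub>laurent_ring Quot poly_ideal h\<^esub>
      (poly_ideal h +>\<^bsub>laurent_ring\<^esub> laurent_T) = \<one>\<^bsub>laurent_ring Quot poly_ideal h\<^esub>"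
    using hom_mult[of laurent_T ?T'] hom_mult[of ?T' laurent_T] hom_one by simp_all
  moreover have "poly_ideal h +>\<^bsub>laurent_ring\<^esub> laurent_T \<in> carrier (laurent_ring Quot poly_ideal h)"
    "poly_ideal h +>\<^bsub>laurent_ring\<^esub> ?T' \<in> carrier (laurent_ring Quot poly_ideal h)"
    by (simp_all add: hom_closed)
  ultimately show ?thesis
    unfolding Units_def by blast
qed

lemma quandle_alexander_quandle_of: "quandle (alexander_quandle_of h)"
  unfolding alexander_quandle_of_def
  by (rule quandle_alexander_quandle[OF cring_poly_quotient laurent_T_coset_unit])

lemma laurent_at_one_superset:
  assumes "finite A" "Poly_Mapping.keys p \<subseteq> A"
  shows "laurent_at_one p = (\<Sum>k\<in>A. Poly_Mapping.lookup p k)"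
  unfolding laurent_at_one_def using assms
  by (intro sum.mono_neutral_left) (auto simp: in_keys_iff)

lemma laurent_at_one_single [simp]: "laurent_at_one (Poly_Mapping.single k c) = c"
  by (simp add: laurent_at_one_superset[of "{k}"] keys_single)

lemma laurent_at_one_0 [simp]: "laurent_at_one 0 = 0"
  by (simp add: laurent_at_one_def)

lemma laurent_at_one_1 [simp]: "laurent_at_one 1 = 1"
  using laurent_at_one_single[of 0 1] by (simp del: laurent_at_one_single)

lemma laurent_at_one_T [simp]: "laurent_at_one laurent_T = 1"
  by (simp add: laurent_T_def)

lemma laurent_at_one_add [simp]: "laurent_at_one (p + q) = laurent_at_one p + laurent_at_one q"
proof -
  let ?A = "Poly_Mapping.keys p \<union> Poly_Mapping.keys q"
  have "laurent_at_one (p + q) = (\<Sum>k\<in>?A. Poly_Mapping.lookup (p + q) k)"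
    by (rule laurent_at_one_superset) (auto simp: Poly_Mapping.keys_add)
  then show ?thesis
    by (simp add: lookup_add sum.distrib laurent_at_one_superset[of ?A])
qed

lemma laurent_at_one_minus [simp]: "laurent_at_one (p - q) = laurent_at_one p - laurent_at_one q"
  using laurent_at_one_add[of "p - q" q] by simp

lemma laurent_induct:
  fixes p :: laurent
  assumes "P 0" "\<And>k c p. P p \<Longrightarrow> P (Poly_Mapping.single k c + p)"
  shows "P p"
proof (induction "card (Poly_Mapping.keys p)" arbitrary: p)
  case 0
  then show ?case using assms(1) by simp
next
  case (Suc n)
  then obtain k where k: "k \<in> Poly_Mapping.keys p" by fastforce
  let ?q = "p - Poly_Mapping.single k (Poly_Mapping.lookup p k)"
  have "Poly_Mapping.keys ?q = Poly_Mapping.keys p - {k}"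
    by (auto simp: in_keys_iff lookup_minus lookup_single when_def split: if_splits)
  then have "P ?q" using Suc k by simp
  then show ?case using assms(2)[of ?q k "Poly_Mapping.lookup p k"] by simp
qed

lemma laurent_at_one_mult [simp]: "laurent_at_one (p * q) = laurent_at_one p * laurent_at_one q"
proof (induction p rule: laurent_induct)
  case (2 k c p)
  have "laurent_at_one (Poly_Mapping.single k c * q) = c * laurent_at_one q"
    by (induction q rule: laurent_induct) (simp_all add: distrib_left mult_single)
  then show ?case using 2 by (simp add: distrib_right)
qed simp

lemma laurent_at_one_of_int [simp]: "laurent_at_one (of_int c) = c"
proof (induction c rule: int_induct[of _ 0])
  case (step1 i) then show ?case by simp
next
  case (step2 i) then show ?case by simp
qed simp

lemma laurent_at_one_of_poly: "laurent_at_one (laurent_of_poly h) = poly h 1"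
  unfolding laurent_of_poly_def
  by (induction h) (simp_all add: map_poly_pCons)

lemma eval_one_coset:
  assumes "poly h 1 = 0"
  shows "eval_one (poly_ideal h +>\<^bsub>laurent_ring\<^esub> p) = laurent_at_one p"
proof -
  have "laurent_at_one x = 0" if "x \<in> poly_ideal h" for x
    using that assms by (auto simp: poly_ideal_def cgenideal_def laurent_at_one_of_poly)
  moreover have "0 \<in> poly_ideal h"
    by (auto simp: poly_ideal_def cgenideal_def intro!: exI[of _ 0])
  ultimately have "laurent_at_one ` (poly_ideal h +>\<^bsub>laurent_ring\<^esub> p) = {laurent_at_one p}"
    by (force simp: a_r_coset_def')
  then show ?thesis by (simp add: eval_one_def)
qed

lemma eval_one_quandle_hom:
  assumes "poly h 1 = 0"
  shows "eval_one \<in> quandle_hom (alexander_quandle_of h) T_infinity"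
proof -
  interpret ring_hom_ring laurent_ring "laurent_ring Quot poly_ideal h" "(+>\<^bsub>laurent_ring\<^esub>) (poly_ideal h)"
    by (rule ideal.rcos_ring_hom_ring[OF ideal_poly_ideal])
  let ?q = "(+>\<^bsub>laurent_ring\<^esub>) (poly_ideal h)"
  have "eval_one (a \<triangleright>\<^bsub>alexander_quandle_of h\<^esub> b) = eval_one a"
    if ab: "a \<in> carrier (alexander_quandle_of h)" "b \<in> carrier (alexander_quandle_of h)" for a b
  proof -
    have "carrier (alexander_quandle_of h) = range ?q"
      by (auto simp: alexander_quandle_of_def alexander_quandle_def FactRing_def A_RCOSETS_def')
    then obtain x y where xy: "a = ?q x" "b = ?q y"
      using ab by auto
    let ?S = "laurent_ring Quot poly_ideal h"
    have "?q (1 - laurent_T) = \<one>\<^bsub>?S\<^esub> \<ominus>\<^bsub>?S\<^esub> ?q laurent_T"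
      using hom_add[of 1 "- laurent_T"] hom_a_inv[of laurent_T] hom_one
      by (simp add: a_minus_def)
    then have "?q (laurent_T * x + (1 - laurent_T) * y) =
        (?q laurent_T \<otimes>\<^bsub>?S\<^esub> a) \<oplus>\<^bsub>?S\<^esub> ((\<one>\<^bsub>?S\<^esub> \<ominus>\<^bsub>?S\<^esub> ?q laurent_T) \<otimes>\<^bsub>?S\<^esub> b)"
      using hom_mult[of laurent_T x] hom_mult[of "1 - laurent_T" y]
        hom_add[of "laurent_T * x" "(1 - laurent_T) * y"]
      by (simp only: xy laurent_ring_simps UNIV_I)
    then have "a \<triangleright>\<^bsub>alexander_quandle_of h\<^esub> b = ?q (laurent_T * x + (1 - laurent_T) * y)"
      by (simp add: alexander_quandle_of_def alexander_quandle_def)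
    then show ?thesis
      by (simp add: xy eval_one_coset[OF assms])
  qed
  then show ?thesis
    by (auto simp: quandle_hom_def T_infinity_def)
qed

end

theory Submission
  imports Defs
begin

text \<open>In \<open>X\<close> one has \<open>0 * 1 = 1 - T\<close> and \<open>(1 - T) * (-T) = 0\<close>, so \<open>(0, 1) + (1 - T, -T)\<close> is a
  2-cycle for every \<open>h\<close>; it maps to \<open>(0, 1) + (0, -1)\<close>. All differentials of the complex of the
  trivial quandle vanish, so the function that is 1 on \<open>(0, 1)\<close> and 0 on all other pairs is a
  2-cocycle there. Its value on the image cycle is 1, and this single nonzero pairing detects
  both induced maps.\<close>

section \<open>Maps of quotient groups\<close>

text \<open>The boundary, the chain map and the map on homology are each \<open>the_elem\<close> of
  the image of a coset; this makes them computable on a representative. Two members of a right coset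
  of \<open>N\<close> differ by a left factor in \<open>N\<close>, whose image lies in
  \<open>M\<close> and is absorbed by the coset of \<open>M\<close>.\<close>

lemma the_elem_coset_image:
  assumes "group_hom G H f" "subgroup N G" "subgroup M H" "f ` N \<subseteq> M" "x \<in> carrier G"
  shows "the_elem ((\<lambda>c. M #>\<^bsub>H\<^esub> f c) ` (N #>\<^bsub>G\<^esub> x)) = M #>\<^bsub>H\<^esub> f x"
proof -
  interpret group_hom G H f by fact
  have "M #>\<^bsub>H\<^esub> f c = M #>\<^bsub>H\<^esub> f x" if c: "c \<in> N #>\<^bsub>G\<^esub> x" for c
  proof -
    obtain k where k: "k \<in> N" "c = k \<otimes>\<^bsub>G\<^esub> x"
      using c by (auto simp: r_coset_def)
    then have kG: "k \<in> carrier G"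
      using assms(2) by (meson subgroup.mem_carrier)
    have "M #>\<^bsub>H\<^esub> f c = (M #>\<^bsub>H\<^esub> f k) #>\<^bsub>H\<^esub> f x"
      using k(2) kG assms(5) subgroup.subset[OF assms(3)] by (simp add: H.coset_mult_assoc)
    also have "M #>\<^bsub>H\<^esub> f k = M"
      using k(1) kG assms(3,4) by (intro H.coset_join2) auto
    finally show ?thesis .
  qed
  moreover have "x \<in> N #>\<^bsub>G\<^esub> x"
    using assms by (simp add: G.rcos_self)
  ultimately have "(\<lambda>c. M #>\<^bsub>H\<^esub> f c) ` (N #>\<^bsub>G\<^esub> x) = {M #>\<^bsub>H\<^esub> f x}"
    by (smt (verit, best) equals0D image_cong image_constant)
  then show ?thesis by simp
qed

text \<open>Normality enters through the product of two cosets: it is the coset of the product, and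
  \<open>f\<close> is multiplicative on representatives.\<close>

lemma the_elem_coset_image_hom:
  assumes "group_hom G H f" "N \<lhd> G" "M \<lhd> H" "f ` N \<subseteq> M"
  shows "(\<lambda>U. the_elem ((\<lambda>c. M #>\<^bsub>H\<^esub> f c) ` U)) \<in> hom (G Mod N) (H Mod M)"
proof -
  interpret group_hom G H f by fact
  note coset = the_elem_coset_image[OF assms(1) normal_imp_subgroup[OF assms(2)]
      normal_imp_subgroup[OF assms(3)] assms(4)]
  show ?thesis
  proof (rule homI)
    fix U V
    assume "U \<in> carrier (G Mod N)" "V \<in> carrier (G Mod N)"
    then obtain x y where xy: "x \<in> carrier G" "y \<in> carrier G" "U = N #>\<^bsub>G\<^esub> x" "V = N #>\<^bsub>G\<^esub> y"
      by (auto simp: carrier_FactGroup)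
    then show "the_elem ((\<lambda>c. M #>\<^bsub>H\<^esub> f c) ` (U \<otimes>\<^bsub>G Mod N\<^esub> V)) =
        the_elem ((\<lambda>c. M #>\<^bsub>H\<^esub> f c) ` U) \<otimes>\<^bsub>H Mod M\<^esub> the_elem ((\<lambda>c. M #>\<^bsub>H\<^esub> f c) ` V)"
      using assms by (simp add: normal.rcos_sum coset)
  qed (auto simp: carrier_FactGroup coset)
qed

text \<open>The unit of a quotient group is the subgroup itself, so this turns triviality of a
  homology class into membership among the boundaries.\<close>

lemma coset_eq_subgroup_iff:
  assumes "group G" "subgroup N G" "x \<in> carrier G"
  shows "N #>\<^bsub>G\<^esub> x = N \<longleftrightarrow> x \<in> N"
  using group.coset_join1[OF assms(1) _ assms(3,2)] group.coset_join2[OF assms(1,3,2)] by blast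

lemma frag_extend_hom:
  assumes "\<And>x. x \<in> S \<Longrightarrow> f x \<in> carrier (free_Abelian_group T)"
  shows "frag_extend f \<in> hom (free_Abelian_group S) (free_Abelian_group T)"
proof (rule homI)
  fix c assume "c \<in> carrier (free_Abelian_group S)"
  then show "frag_extend f c \<in> carrier (free_Abelian_group T)"
    using assms keys_frag_extend[of f c] by fastforce
qed (simp add: frag_extend_add)

text \<open>Degenerate chains are given by generators, so stability under the boundary and under
  chain maps, and vanishing of a cochain on them, can be checked on single tuples.\<close>

lemma group_hom_image_generate_subset:
  assumes "group_hom G H f" "subgroup M H" "S \<subseteq> carrier G" "f ` S \<subseteq> M"
  shows "f ` generate G S \<subseteq> M"
proof -
  interpret group_hom G H f by fact
  show ?thesis
    using generate_img[OF assms(3)] H.generate_subgroup_incl[OF assms(4,2)] by simp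
qed

section \<open>The quandle complex\<close>

lemma comm_group_rack_chains: "comm_group (rack_chains Q n)"
  by (simp add: rack_chains_def abelian_free_Abelian_group)

lemma group_rack_chains [simp]: "group (rack_chains Q n)"
  by (simp add: rack_chains_def)

lemma normal_degenerate_chains: "degenerate_chains Q n \<lhd> rack_chains Q n"
proof -
  interpret comm_group "rack_chains Q n" by (rule comm_group_rack_chains)
  have "frag_of ` {xs \<in> tuples Q n. \<exists>i. Suc i < length xs \<and> xs ! i = xs ! Suc i}
      \<subseteq> carrier (rack_chains Q n)"
    by (auto simp: rack_chains_def)
  then show ?thesis
    unfolding degenerate_chains_def by (intro subgroup_imp_normal generate_is_subgroup)
qed

lemmas subgroup_degenerate_chains = normal_imp_subgroup[OF normal_degenerate_chains]

lemma frag_of_in_degenerate_chains: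
  assumes "xs \<in> tuples Q n" "Suc j < length xs" "xs ! j = xs ! Suc j"
  shows "frag_of xs \<in> degenerate_chains Q n"
  unfolding degenerate_chains_def by (rule generate.incl) (use assms in blast)

lemma degenerate_chains_diff:
  assumes "a \<in> degenerate_chains Q n" "b \<in> degenerate_chains Q n"
  shows "a - b \<in> degenerate_chains Q n"
proof -
  interpret D: subgroup "degenerate_chains Q n" "rack_chains Q n"
    by (rule subgroup_degenerate_chains)
  \<comment> \<open>Inversion in the free abelian group is negation only on its carrier, so the
    support of \<open>b\<close> has to be known.\<close>
  have "Poly_Mapping.keys b \<subseteq> tuples Q n"
    using D.mem_carrier[OF assms(2)] by (simp add: rack_chains_def)
  then show ?thesis
    using D.m_closed[OF assms(1) D.m_inv_closed[OF assms(2)]] by (simp add: rack_chains_def)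
qed

lemma degenerate_chains_cmul:
  assumes "a \<in> degenerate_chains Q n"
  shows "frag_cmul k a \<in> degenerate_chains Q n"
proof -
  have "a [^]\<^bsub>rack_chains Q n\<^esub> k \<in> degenerate_chains Q n"
    using assms by (intro group.subgroup_int_pow_closed subgroup_degenerate_chains group_rack_chains)
  moreover have "Poly_Mapping.keys a \<subseteq> tuples Q n"
    using subgroup.mem_carrier[OF subgroup_degenerate_chains assms] by (simp add: rack_chains_def)
  ultimately show ?thesis
    by (simp add: rack_chains_def)
qed

lemma degenerate_chains_sum:
  assumes "\<And>i. i \<in> I \<Longrightarrow> f i \<in> degenerate_chains Q n"
  shows "(\<Sum>i\<in>I. f i) \<in> degenerate_chains Q n"
proof -
  interpret D: subgroup "degenerate_chains Q n" "rack_chains Q n"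
    by (rule subgroup_degenerate_chains)
  have "0 \<in> degenerate_chains Q n" "\<And>a b. \<lbrakk>a \<in> degenerate_chains Q n; b \<in> degenerate_chains Q n\<rbrakk>
      \<Longrightarrow> a + b \<in> degenerate_chains Q n"
    using D.one_closed D.m_closed by (simp_all add: rack_chains_def)
  then show ?thesis
    using assms by (induction I rule: infinite_finite_induct) auto
qed

section \<open>Faces, and the boundary of a degenerate tuple\<close>

lemma (in quandle) face_in_tuples:
  assumes "xs \<in> tuples Q n" "i \<in> {2..length xs}"
  shows "take (i - 1) xs @ drop i xs \<in> tuples Q (n - 1)"
    and "map (\<lambda>y. y \<triangleright> (xs ! (i - 1))) (take (i - 1) xs) @ drop i xs \<in> tuples Q (n - 1)"
proof -
  have "xs ! (i - 1) \<in> carrier Q"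
    using assms by (auto simp: tuples_def)
  \<comment> \<open>Since \<open>i\<close> is at least 2, the shortened list keeps length at least
    1, as membership in \<open>tuples\<close> demands.\<close>
  then show "take (i - 1) xs @ drop i xs \<in> tuples Q (n - 1)"
    and "map (\<lambda>y. y \<triangleright> (xs ! (i - 1))) (take (i - 1) xs) @ drop i xs \<in> tuples Q (n - 1)"
    using assms by (auto simp: tuples_def closed dest!: in_set_takeD in_set_dropD)
qed

lemma (in quandle) rack_boundary_hom:
  "rack_boundary Q \<in> hom (rack_chains Q n) (rack_chains Q (n - 1))"
  unfolding rack_boundary_def rack_chains_def
proof (rule frag_extend_hom, rule sum_closed_free_Abelian_group)
  fix xs i assume "xs \<in> tuples Q n" "i \<in> {2..length xs}"
  note face_in_tuples[OF this]
  then show "frag_cmul ((-1) ^ i) (frag_of (take (i - 1) xs @ drop i xs)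
     - frag_of (map (\<lambda>y. y \<triangleright> (xs ! (i - 1))) (take (i - 1) xs) @ drop i xs))
     \<in> carrier (free_Abelian_group (tuples Q (n - 1)))"
    by (auto simp: keys_frag_of dest!: subsetD[OF keys_diff])
qed

text \<open>Removing an entry outside the equal pair keeps the pair adjacent: for
  \<open>k < j\<close> it lies in the untouched tail and moves one place left, otherwise both
  members lie in the prefix and \<open>g\<close> keeps them equal. Taking \<open>g\<close> as
  \<open>id\<close> or as a translation covers both kinds of face.\<close>

lemma nth_eq_Suc_face:
  fixes g :: "'a \<Rightarrow> 'a"
  assumes "Suc j < length xs" "xs ! j = xs ! Suc j" "k < length xs" "k \<noteq> j" "k \<noteq> Suc j"
  defines "ys \<equiv> map g (take k xs) @ drop (Suc k) xs"
  shows "\<exists>i. Suc i < length ys \<and> ys ! i = ys ! Suc i"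
proof (cases "k < j")
  case True
  then obtain m where j: "j = Suc m" "k \<le> m" by (cases j) auto
  then have "Suc m < length ys" "ys ! m = ys ! Suc m"
    using assms by (auto simp: nth_append)
  then show ?thesis by blast
next
  case False
  then have "Suc j < length ys" "ys ! j = ys ! Suc j"
    using assms by (auto simp: nth_append)
  then show ?thesis by blast
qed

text \<open>Faces that omit an entry outside the equal pair are again degenerate; omitting one or
  the other member of the pair gives coinciding faces with opposite signs.\<close>

lemma (in quandle) rack_boundary_frag_of_degenerate:
  assumes xs: "xs \<in> tuples Q n" and j: "Suc j < length xs" "xs ! j = xs ! Suc j"
  shows "rack_boundary Q (frag_of xs) \<in> degenerate_chains Q (n - 1)"
proof -
  define A where "A i = take (i - 1) xs @ drop i xs" for i
  define B where "B i = map (\<lambda>y. y \<triangleright> (xs ! (i - 1))) (take (i - 1) xs) @ drop i xs" for i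
  define t where "t i = frag_cmul ((-1) ^ i) (frag_of (A i) - frag_of (B i))" for i
  \<comment> \<open>With numbering from 1, these are the positions of the equal pair.\<close>
  let ?J = "{Suc j, Suc (Suc j)}"
  \<comment> \<open>the summand for \<open>i = 1\<close> vanishes, so it can be added to make the sum symmetric in \<open>j\<close>\<close>
  have "rack_boundary Q (frag_of xs) = (\<Sum>i = 2..length xs. t i)"
    by (simp add: rack_boundary_def t_def A_def B_def)
  also have "\<dots> = (\<Sum>i = 1..length xs. t i)"
  proof (rule sum.mono_neutral_left)
    show "\<forall>i \<in> {1..length xs} - {2..length xs}. t i = 0"
    proof
      fix i assume "i \<in> {1..length xs} - {2..length xs}"
      then have "i = 1" by auto
      then show "t i = 0" by (simp add: t_def A_def B_def)
    qed
  qed auto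
  also have "\<dots> = (\<Sum>i \<in> {1..length xs} - ?J. t i) + (\<Sum>i \<in> ?J. t i)"
    using j by (intro sum.subset_diff) auto
  also have "(\<Sum>i \<in> ?J. t i) = 0"
  proof -
    have take: "take (Suc j) xs = take j xs @ [xs ! j]"
      using j by (simp add: take_Suc_conv_app_nth)
    have drop: "drop (Suc j) xs = xs ! Suc j # drop (Suc (Suc j)) xs"
      using j by (simp add: Cons_nth_drop_Suc)
    \<comment> \<open>Idempotence identifies the translated faces: omitting the second member leaves
      \<open>xs ! j\<close>, translated by its own value, in the place of
      \<open>xs ! Suc j\<close>.\<close>
    have "xs ! Suc j \<triangleright> xs ! Suc j = xs ! Suc j"
      using xs j by (auto intro!: idem simp: tuples_def)
    then have "A (Suc j) = A (Suc (Suc j))" "B (Suc j) = B (Suc (Suc j))"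
      using j by (simp_all add: A_def B_def take drop)
    then show ?thesis by (simp add: t_def flip: frag_cmul_distrib)
  qed
  also have "(\<Sum>i \<in> {1..length xs} - ?J. t i) + 0 \<in> degenerate_chains Q (n - 1)"
    unfolding add_0_right
  proof (rule degenerate_chains_sum)
    fix i assume i: "i \<in> {1..length xs} - ?J"
    show "t i \<in> degenerate_chains Q (n - 1)"
    proof (cases "i = 1")
      case True
      \<comment> \<open>The empty sum provides degeneracy of 0.\<close>
      then show ?thesis
        using degenerate_chains_sum[of "{}"] by (simp add: t_def A_def B_def)
    next
      case False
      \<comment> \<open>\<open>k\<close> is the list position, counted from 0, of the omitted
        entry.\<close>
      then obtain k where k: "i = Suc k" "k < length xs" "k \<noteq> j" "k \<noteq> Suc j" "0 < k"
        using i by (cases i) auto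
      then have "i \<in> {2..length xs}" by auto
      note tuples = face_in_tuples[OF xs this]
      have "frag_of (A i) \<in> degenerate_chains Q (n - 1)"
        using nth_eq_Suc_face[OF j k(2-4), of id] frag_of_in_degenerate_chains[OF tuples(1)]
        unfolding A_def k(1) by fastforce
      moreover have "frag_of (B i) \<in> degenerate_chains Q (n - 1)"
        using nth_eq_Suc_face[OF j k(2-4), of "\<lambda>y. y \<triangleright> (xs ! k)"] frag_of_in_degenerate_chains[OF tuples(2)]
        unfolding B_def k(1) by fastforce
      ultimately show ?thesis
        unfolding t_def by (intro degenerate_chains_cmul degenerate_chains_diff)
    qed
  qed
  finally show ?thesis .
qed

lemma (in quandle) group_hom_rack_boundary:
  "group_hom (rack_chains Q n) (rack_chains Q (n - 1)) (rack_boundary Q)"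
  by (simp add: group_hom_def group_hom_axioms_def rack_boundary_hom)

lemma (in quandle) rack_boundary_degenerate_chains:
  "rack_boundary Q ` degenerate_chains Q n \<subseteq> degenerate_chains Q (n - 1)"
  unfolding degenerate_chains_def[of Q n]
  by (rule group_hom_image_generate_subset[OF group_hom_rack_boundary subgroup_degenerate_chains])
    (auto simp: rack_chains_def intro: rack_boundary_frag_of_degenerate)

section \<open>The quotient complex\<close>

lemma group_quandle_chains [simp]: "group (quandle_chains Q n)"
  unfolding quandle_chains_def by (rule normal.factorgroup_is_group[OF normal_degenerate_chains])

lemma (in quandle) group_hom_quandle_boundary:
  "group_hom (quandle_chains Q n) (quandle_chains Q (n - 1)) (quandle_boundary Q n)"
proof -
  have "quandle_boundary Q n \<in> hom (quandle_chains Q n) (quandle_chains Q (n - 1))"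
    unfolding quandle_boundary_def quandle_chains_def
    by (rule the_elem_coset_image_hom[OF group_hom_rack_boundary normal_degenerate_chains
          normal_degenerate_chains rack_boundary_degenerate_chains])
  then show ?thesis by (simp add: group_hom_def group_hom_axioms_def)
qed

lemma (in quandle) quandle_boundary_coset:
  assumes "c \<in> carrier (rack_chains Q n)"
  shows "quandle_boundary Q n (degenerate_chains Q n #>\<^bsub>rack_chains Q n\<^esub> c) =
    degenerate_chains Q (n - 1) #>\<^bsub>rack_chains Q (n - 1)\<^esub> rack_boundary Q c"
  unfolding quandle_boundary_def
  by (rule the_elem_coset_image[OF group_hom_rack_boundary subgroup_degenerate_chains
        subgroup_degenerate_chains rack_boundary_degenerate_chains assms])

section \<open>Functoriality\<close>

lemma map_in_tuples:
  assumes "f \<in> carrier Q \<rightarrow> carrier Q'" "xs \<in> tuples Q n"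
  shows "map f xs \<in> tuples Q' n"
  using assms by (auto simp: tuples_def)

lemma group_hom_rack_chain_map:
  assumes "f \<in> carrier Q \<rightarrow> carrier Q'"
  shows "group_hom (rack_chains Q n) (rack_chains Q' n) (frag_extend (\<lambda>xs. frag_of (map f xs)))"
proof -
  have "frag_extend (\<lambda>xs. frag_of (map f xs)) \<in> hom (rack_chains Q n) (rack_chains Q' n)"
    unfolding rack_chains_def by (rule frag_extend_hom) (simp add: map_in_tuples[OF assms])
  then show ?thesis by (simp add: group_hom_def group_hom_axioms_def)
qed

lemma rack_chain_map_degenerate_chains:
  assumes "f \<in> carrier Q \<rightarrow> carrier Q'"
  shows "frag_extend (\<lambda>xs. frag_of (map f xs)) ` degenerate_chains Q n \<subseteq> degenerate_chains Q' n"
  unfolding degenerate_chains_def[of Q n]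
  by (rule group_hom_image_generate_subset[OF group_hom_rack_chain_map[OF assms]
        subgroup_degenerate_chains])
    (auto simp: rack_chains_def map_in_tuples[OF assms] intro!: frag_of_in_degenerate_chains)

lemma group_hom_quandle_chain_map:
  assumes "f \<in> carrier Q \<rightarrow> carrier Q'"
  shows "group_hom (quandle_chains Q n) (quandle_chains Q' n) (quandle_chain_map Q' f n)"
proof -
  have "quandle_chain_map Q' f n \<in> hom (quandle_chains Q n) (quandle_chains Q' n)"
    unfolding quandle_chain_map_def quandle_chains_def
    by (rule the_elem_coset_image_hom[OF group_hom_rack_chain_map[OF assms]
          normal_degenerate_chains normal_degenerate_chains
          rack_chain_map_degenerate_chains[OF assms]])
  then show ?thesis by (simp add: group_hom_def group_hom_axioms_def)
qed

lemma quandle_chain_map_coset: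
  assumes "f \<in> carrier Q \<rightarrow> carrier Q'" "c \<in> carrier (rack_chains Q n)"
  shows "quandle_chain_map Q' f n (degenerate_chains Q n #>\<^bsub>rack_chains Q n\<^esub> c) =
    degenerate_chains Q' n #>\<^bsub>rack_chains Q' n\<^esub> frag_extend (\<lambda>xs. frag_of (map f xs)) c"
  unfolding quandle_chain_map_def
  by (rule the_elem_coset_image[OF group_hom_rack_chain_map[OF assms(1)]
        subgroup_degenerate_chains subgroup_degenerate_chains
        rack_chain_map_degenerate_chains[OF assms(1)] assms(2)])

text \<open>Both sides are additive in \<open>c\<close>, so single tuples suffice. There, deleting
  an entry commutes with \<open>map f\<close> at once; the translated faces use the homomorphism
  law, which applies because all entries lie in the carrier.\<close>

lemma rack_chain_map_boundary:
  assumes f: "f \<in> quandle_hom Q Q'" and c: "c \<in> carrier (rack_chains Q n)"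
  shows "frag_extend (\<lambda>xs. frag_of (map f xs)) (rack_boundary Q c) =
    rack_boundary Q' (frag_extend (\<lambda>xs. frag_of (map f xs)) c)"
proof -
  have "Poly_Mapping.keys c \<subseteq> tuples Q n"
    using c by (simp add: rack_chains_def)
  then show ?thesis
  proof (induction c rule: frag_induction)
    case (one xs)
    have face: "map f (map (\<lambda>y. y \<triangleright>\<^bsub>Q\<^esub> (xs ! (i - 1))) (take (i - 1) xs)) =
        map (\<lambda>y. y \<triangleright>\<^bsub>Q'\<^esub> (map f xs ! (i - 1))) (map f (take (i - 1) xs))"
      if "i \<in> {2..length xs}" for i
    proof -
      have "xs ! (i - 1) \<in> carrier Q" using that one by (auto simp: tuples_def)
      then show ?thesis
        using that f one unfolding quandle_hom_def tuples_def
        by (auto simp del: One_nat_def dest!: in_set_takeD)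
    qed
    show ?case
      unfolding rack_boundary_def frag_extend_of
      by (simp add: frag_extend_sum frag_extend_cmul frag_extend_diff take_map drop_map face
          del: One_nat_def map_map)
  qed (simp_all add: rack_boundary_def frag_extend_diff)
qed

lemma quandle_chain_map_boundary:
  assumes "quandle Q" "quandle Q'" and f: "f \<in> quandle_hom Q Q'"
    and U: "U \<in> carrier (quandle_chains Q n)"
  shows "quandle_chain_map Q' f (n - 1) (quandle_boundary Q n U) =
    quandle_boundary Q' n (quandle_chain_map Q' f n U)"
proof -
  obtain c where c: "c \<in> carrier (rack_chains Q n)"
      "U = degenerate_chains Q n #>\<^bsub>rack_chains Q n\<^esub> c"
    using U by (auto simp: quandle_chains_def carrier_FactGroup)
  have f': "f \<in> carrier Q \<rightarrow> carrier Q'"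
    using f by (simp add: quandle_hom_def)
  let ?f = "frag_extend (\<lambda>xs. frag_of (map f xs))"
  have "rack_boundary Q c \<in> carrier (rack_chains Q (n - 1))"
    using group_hom.hom_closed[OF quandle.group_hom_rack_boundary[OF assms(1)] c(1)] .
  then have "quandle_chain_map Q' f (n - 1) (quandle_boundary Q n U) =
      degenerate_chains Q' (n - 1) #>\<^bsub>rack_chains Q' (n - 1)\<^esub> ?f (rack_boundary Q c)"
    unfolding c(2) quandle.quandle_boundary_coset[OF assms(1) c(1)]
    by (rule quandle_chain_map_coset[OF f'])
  also have "\<dots> = degenerate_chains Q' (n - 1) #>\<^bsub>rack_chains Q' (n - 1)\<^esub> rack_boundary Q' (?f c)"
    by (simp only: rack_chain_map_boundary[OF f c(1)])
  also have "\<dots> = quandle_boundary Q' n (degenerate_chains Q' n #>\<^bsub>rack_chains Q' n\<^esub> ?f c)"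
    using group_hom.hom_closed[OF group_hom_rack_chain_map[OF f'] c(1)]
    by (rule quandle.quandle_boundary_coset[OF assms(2), symmetric])
  also have "\<dots> = quandle_boundary Q' n (quandle_chain_map Q' f n U)"
    unfolding c(2) quandle_chain_map_coset[OF f' c(1)] ..
  finally show ?thesis .
qed

section \<open>Cochains\<close>

lemma restrict_in_cochain_group:
  assumes "group (C n)" "\<phi> \<in> hom (C n) integer_group"
  shows "restrict \<phi> (carrier (C n)) \<in> carrier (cochain_group C n)"
proof -
  interpret group "C n" by fact
  show ?thesis
    using assms(2) by (simp add: cochain_group_def Hom_group_def hom_def)
qed

lemma cochain_one:
  assumes "group (C n)" "\<phi> \<in> carrier (cochain_group C n)"
  shows "\<phi> \<one>\<^bsub>C n\<^esub> = 0"
  using hom_one[of \<phi> "C n" integer_group] assms by (simp add: cochain_group_def Hom_group_def)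

lemma zero_cochain: "(\<lambda>x\<in>carrier (C n). 0) \<in> carrier (cochain_group C n)" if "group (C n)"
  using that by (intro restrict_in_cochain_group) (auto simp: hom_def)

lemma compose_in_cochain_group:
  assumes "group_hom (C n) (C' n) f" "\<phi> \<in> carrier (cochain_group C' n)"
  shows "compose (carrier (C n)) \<phi> f \<in> carrier (cochain_group C n)"
proof -
  interpret group_hom "C n" "C' n" f by fact
  show ?thesis
    using assms(2) G.hom_compose[OF homh, of \<phi> integer_group]
    by (simp add: cochain_group_def Hom_group_def compose_extensional)
qed

text \<open>Evaluation at the cycle \<open>c\<close> detects the class: a coboundary takes at
  \<open>c\<close> the value \<open>\<eta> (d n c)\<close>, that of a homomorphism at the unit,
  which is 0.\<close>

lemma coset_coboundaries_nontrivial: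
  assumes d: "group_hom (C n) (C (n - 1)) (d n)"
    and c: "c \<in> carrier (C n)" "d n c = \<one>\<^bsub>C (n - 1)\<^esub>" and \<psi>: "\<psi> c \<noteq> 0"
  defines "B \<equiv> coboundary C d (n - 1) ` carrier (cochain_group C (n - 1))"
  shows "B #>\<^bsub>cochain_group C n\<^esub> \<psi> \<noteq> B"
proof
  assume eq: "B #>\<^bsub>cochain_group C n\<^esub> \<psi> = B"
  interpret group_hom "C n" "C (n - 1)" "d n" by (rule d)
  \<comment> \<open>The zero coboundary puts the sum of 0 and \<open>\<psi>\<close>, which agrees
    with \<open>\<psi>\<close> at \<open>c\<close>, into the coset and hence among the
    coboundaries.\<close>
  have "coboundary C d (n - 1) (\<lambda>x\<in>carrier (C (n - 1)). 0) \<in> B"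
    unfolding B_def by (intro imageI zero_cochain H.is_group)
  then have "coboundary C d (n - 1) (\<lambda>x\<in>carrier (C (n - 1)). 0) \<otimes>\<^bsub>cochain_group C n\<^esub> \<psi> \<in> B"
    using eq by (auto simp: r_coset_def)
  then obtain \<eta> where \<eta>: "\<eta> \<in> carrier (cochain_group C (n - 1))"
    "coboundary C d (n - 1) (\<lambda>x\<in>carrier (C (n - 1)). 0) \<otimes>\<^bsub>cochain_group C n\<^esub> \<psi> =
      coboundary C d (n - 1) \<eta>"
    by (auto simp: B_def)
  have "\<psi> c = \<eta> \<one>\<^bsub>C (n - 1)\<^esub>"
    using fun_cong[OF \<eta>(2), of c] c
    by (simp add: cochain_group_def Hom_group_def coboundary_def compose_def)
  then show False
    using cochain_one[OF H.is_group \<eta>(1)] \<psi> by simp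
qed

text \<open>The cochain dual to a basis tuple: reading off the coefficient of \<open>xs\<close>
  kills every degenerate generator because \<open>xs\<close> has no equal neighbours, so it factors
  through the quotient.\<close>

lemma cochain_of_tuple:
  assumes "xs \<in> tuples Q n" "\<And>j. Suc j < length xs \<Longrightarrow> xs ! j \<noteq> xs ! Suc j"
  obtains \<phi> where "\<phi> \<in> carrier (cochain_group (quandle_chains Q) n)"
    "\<And>c. c \<in> carrier (rack_chains Q n) \<Longrightarrow>
      \<phi> (degenerate_chains Q n #>\<^bsub>rack_chains Q n\<^esub> c) = Poly_Mapping.lookup c xs"
proof -
  let ?R = "rack_chains Q n" and ?D = "degenerate_chains Q n"
  let ?l = "\<lambda>c :: 'a list \<Rightarrow>\<^sub>0 int. Poly_Mapping.lookup c xs"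
  interpret l: group_hom ?R integer_group ?l
    by (simp add: group_hom_def group_hom_axioms_def rack_chains_def hom_def lookup_add)
  have "?l ` ?D \<subseteq> {0}"
    unfolding degenerate_chains_def
    by (rule group_hom_image_generate_subset[OF l.group_hom_axioms])
      (use assms l.H.triv_subgroup in \<open>auto simp: rack_chains_def lookup_frag_of\<close>)
  then have l0: "?l d = 0" if "d \<in> ?D" for d
    using that by auto
  have "?l x = ?l y" if "x \<in> carrier ?R" "y \<in> carrier ?R" "?D #>\<^bsub>?R\<^esub> x = ?D #>\<^bsub>?R\<^esub> y" for x y
  proof -
    have "x \<in> ?D #>\<^bsub>?R\<^esub> y"
      using l.G.rcos_self[OF that(1) subgroup_degenerate_chains] that(3) by simp
    then show ?thesis
      by (auto simp: r_coset_def rack_chains_def lookup_add l0)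
  qed
  then obtain \<phi> where \<phi>: "\<phi> \<in> hom (?R Mod ?D) integer_group"
      "\<And>c. c \<in> carrier ?R \<Longrightarrow> \<phi> (?D #>\<^bsub>?R\<^esub> c) = ?l c"
    using FactGroup_universal[OF l.homh normal_degenerate_chains] by blast
  show thesis
  proof
    \<comment> \<open>The factored map is arbitrary off the carrier, while cochains are
      extensional.\<close>
    show "restrict \<phi> (carrier (?R Mod ?D)) \<in> carrier (cochain_group (quandle_chains Q) n)"
      using restrict_in_cochain_group[where C = "quandle_chains Q", OF group_quandle_chains] \<phi>(1)
      by (simp add: quandle_chains_def)
  qed (use \<phi>(2) in \<open>auto simp: carrier_FactGroup\<close>)
qed

section \<open>The trivial quandle\<close>

text \<open>Every translation is the identity, so the two faces in each summand coincide.\<close>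

lemma rack_boundary_T_infinity: "rack_boundary T_infinity c = 0"
  by (simp add: rack_boundary_def T_infinity_def frag_extend_eq_0)

lemma quandle_boundary_T_infinity:
  assumes "U \<in> carrier (quandle_chains T_infinity n)"
  shows "quandle_boundary T_infinity n U = \<one>\<^bsub>quandle_chains T_infinity (n - 1)\<^esub>"
proof -
  interpret R: group "rack_chains T_infinity (n - 1)" by simp
  obtain c where c: "c \<in> carrier (rack_chains T_infinity n)"
      "U = degenerate_chains T_infinity n #>\<^bsub>rack_chains T_infinity n\<^esub> c"
    using assms by (auto simp: quandle_chains_def carrier_FactGroup)
  have "rack_boundary T_infinity c = \<one>\<^bsub>rack_chains T_infinity (n - 1)\<^esub>"
    by (simp add: rack_boundary_T_infinity rack_chains_def)
  then show ?thesis
    using quandle.quandle_boundary_coset[OF quandle_T_infinity c(1)]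
      R.coset_mult_one[OF subgroup.subset[OF subgroup_degenerate_chains]]
    by (simp add: c(2) quandle_chains_def)
qed

lemma coboundary_T_infinity:
  assumes "\<phi> \<in> carrier (cochain_group (quandle_chains T_infinity) n)"
  shows "coboundary (quandle_chains T_infinity) (quandle_boundary T_infinity) n \<phi> =
    \<one>\<^bsub>cochain_group (quandle_chains T_infinity) (n + 1)\<^esub>"
proof -
  have "\<phi> (quandle_boundary T_infinity (n + 1) U) = 0"
    if "U \<in> carrier (quandle_chains T_infinity (n + 1))" for U
    using quandle_boundary_T_infinity[OF that] cochain_one[OF group_quandle_chains assms] by simp
  then show ?thesis
    unfolding coboundary_def compose_def by (auto simp: cochain_group_def Hom_group_def)
qed

text \<open>The pairing argument for any quandle over \<open>T_infinity\<close> and any degree. The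
  coefficient of \<open>xs\<close> in the image of \<open>c\<close> is both the value of the dual
  cochain on the image cycle and the value of its pullback on the class of \<open>c\<close>, so one
  nonzero number serves both claims.\<close>

lemma quandle_maps_to_T_infinity_nontrivial:
  assumes Q: "quandle Q" and f: "f \<in> quandle_hom Q T_infinity"
    and c: "c \<in> carrier (rack_chains Q n)" "rack_boundary Q c = 0"
    and xs: "xs \<in> tuples T_infinity n" "\<And>j. Suc j < length xs \<Longrightarrow> xs ! j \<noteq> xs ! Suc j"
    and pairing: "Poly_Mapping.lookup (frag_extend (\<lambda>xs. frag_of (map f xs)) c) xs \<noteq> 0"
  shows "\<exists>u \<in> carrier (quandle_homology n Q).
      u \<noteq> \<one>\<^bsub>quandle_homology n Q\<^esub> \<and>
      quandle_homology_map n Q T_infinity f u \<noteq> \<one>\<^bsub>quandle_homology n T_infinity\<^esub>"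
    and "\<exists>v \<in> carrier (quandle_cohomology n T_infinity).
      quandle_cohomology_map n Q T_infinity f v \<in> carrier (quandle_cohomology n Q) \<and>
      quandle_cohomology_map n Q T_infinity f v \<noteq> \<one>\<^bsub>quandle_cohomology n Q\<^esub>"
proof -
  let ?X = "quandle_chains Q" and ?Y = "quandle_chains T_infinity"
  let ?dX = "quandle_boundary Q" and ?dY = "quandle_boundary T_infinity"
  let ?F = "quandle_chain_map T_infinity f"
  define z where "z = degenerate_chains Q n #>\<^bsub>rack_chains Q n\<^esub> c"
  have f': "f \<in> carrier Q \<rightarrow> carrier T_infinity"
    using f by (simp add: quandle_hom_def)
  interpret F: group_hom "?X n" "?Y n" "?F n"
    by (rule group_hom_quandle_chain_map[OF f'])
  interpret dn: group_hom "?X n" "?X (n - 1)" "?dX n"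
    by (rule quandle.group_hom_quandle_boundary[OF Q])
  interpret dn1: group_hom "?X (n + 1)" "?X n" "?dX (n + 1)"
    using quandle.group_hom_quandle_boundary[OF Q, of "n + 1"] by simp
  interpret dY: group_hom "?Y (n + 1)" "?Y n" "?dY (n + 1)"
    using quandle.group_hom_quandle_boundary[OF quandle_T_infinity, of "n + 1"] by simp
  have zX: "z \<in> carrier (?X n)"
    using c(1) by (auto simp: z_def quandle_chains_def carrier_FactGroup)
  have dz: "?dX n z = \<one>\<^bsub>?X (n - 1)\<^esub>"
  proof -
    have "\<one>\<^bsub>rack_chains Q (n - 1)\<^esub> = 0" by (simp add: rack_chains_def)
    then show ?thesis
      using group.coset_mult_one[OF group_rack_chains
          subgroup.subset[OF subgroup_degenerate_chains], of Q "n - 1"]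
      by (simp add: z_def quandle.quandle_boundary_coset[OF Q c(1)] c(2) quandle_chains_def)
  qed
  \<comment> \<open>Boundaries have trivial image, since the chain map commutes with the boundary,
    which is trivial in the target. Hence \<open>z\<close> is no boundary, and the pullback of
    \<open>\<phi>\<close> is a cocycle.\<close>
  have Fd: "?F n (?dX (n + 1) w) = \<one>\<^bsub>?Y n\<^esub>" if "w \<in> carrier (?X (n + 1))" for w
  proof -
    have "?F (n + 1) w \<in> carrier (?Y (n + 1))"
      using group_hom.hom_closed[OF group_hom_quandle_chain_map[OF f'] that] .
    then show ?thesis
      using quandle_chain_map_boundary[OF Q quandle_T_infinity f that]
        quandle_boundary_T_infinity[of _ "n + 1"] by simp
  qed
  obtain \<phi> where \<phi>: "\<phi> \<in> carrier (cochain_group ?Y n)"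
      "\<And>c. c \<in> carrier (rack_chains T_infinity n) \<Longrightarrow>
        \<phi> (degenerate_chains T_infinity n #>\<^bsub>rack_chains T_infinity n\<^esub> c) = Poly_Mapping.lookup c xs"
    using cochain_of_tuple[OF xs] by blast
  have \<phi>_one: "\<phi> \<one>\<^bsub>?Y n\<^esub> = 0"
    by (rule cochain_one[OF F.H.is_group \<phi>(1)])
  have \<phi>z: "\<phi> (?F n z) \<noteq> 0"
    using pairing \<phi>(2)[OF group_hom.hom_closed[OF group_hom_rack_chain_map[OF f'] c(1)]]
    by (simp add: z_def quandle_chain_map_coset[OF f' c(1)])
  then have Fz: "?F n z \<noteq> \<one>\<^bsub>?Y n\<^esub>"
    using \<phi>_one by auto

  let ?BX = "?dX (n + 1) ` carrier (?X (n + 1))" and ?BY = "?dY (n + 1) ` carrier (?Y (n + 1))"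
  \<comment> \<open>The target has only the trivial boundary, so nontriviality of the image class
    amounts to \<open>Fz\<close>.\<close>
  have BY: "?BY = {\<one>\<^bsub>?Y n\<^esub>}"
    using quandle_boundary_T_infinity[of _ "n + 1"] dY.G.one_closed
    by (force simp: image_iff)
  \<comment> \<open>Restricting the carrier to cycles leaves cosets unchanged as sets, so the class
    can be written in the full chain group.\<close>
  have u: "?BX #>\<^bsub>?X n\<^esub> z \<in> carrier (quandle_homology n Q)"
    using zX dz
    by (auto simp: quandle_homology_def homology_group_def carrier_FactGroup kernel_def)
  have "z \<notin> ?BX"
    using Fd Fz by auto
  then have "?BX #>\<^bsub>?X n\<^esub> z \<noteq> ?BX"
    by (simp add: coset_eq_subgroup_iff[OF F.G.is_group dn1.img_is_subgroup zX])
  moreover have "quandle_homology_map n Q T_infinity f (?BX #>\<^bsub>?X n\<^esub> z) = ?BY #>\<^bsub>?Y n\<^esub> ?F n z"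
    unfolding quandle_homology_map_def homology_map_def
    by (rule the_elem_coset_image[OF F.group_hom_axioms dn1.img_is_subgroup dY.img_is_subgroup _ zX])
      (auto simp: BY Fd)
  moreover have "?BY #>\<^bsub>?Y n\<^esub> ?F n z \<noteq> ?BY"
    unfolding coset_eq_subgroup_iff[OF F.H.is_group dY.img_is_subgroup F.hom_closed[OF zX]]
    using Fz by (simp add: BY)
  ultimately show "\<exists>u \<in> carrier (quandle_homology n Q).
      u \<noteq> \<one>\<^bsub>quandle_homology n Q\<^esub> \<and>
      quandle_homology_map n Q T_infinity f u \<noteq> \<one>\<^bsub>quandle_homology n T_infinity\<^esub>"
    using u by (metis homology_group_def one_FactGroup quandle_homology_def)

  let ?\<psi> = "compose (carrier (?X n)) \<phi> (?F n)"
  let ?CX = "coboundary ?X ?dX (n - 1) ` carrier (cochain_group ?X (n - 1))"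
    and ?CY = "coboundary ?Y ?dY (n - 1) ` carrier (cochain_group ?Y (n - 1))"
  have \<psi>: "?\<psi> \<in> carrier (cochain_group ?X n)"
    by (rule compose_in_cochain_group[where C = ?X and C' = ?Y, OF F.group_hom_axioms \<phi>(1)])
  have "coboundary ?X ?dX n ?\<psi> = \<one>\<^bsub>cochain_group ?X (n + 1)\<^esub>"
    using dn1.hom_closed
    by (auto simp: coboundary_def compose_def cochain_group_def Hom_group_def Fd \<phi>_one)
  then have \<psi>_class: "?CX #>\<^bsub>cochain_group ?X n\<^esub> ?\<psi> \<in> carrier (quandle_cohomology n Q)"
    using \<psi> by (auto simp: quandle_cohomology_def cohomology_group_def carrier_FactGroup kernel_def)
  have \<psi>_nontrivial: "?CX #>\<^bsub>cochain_group ?X n\<^esub> ?\<psi> \<noteq> ?CX"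
    by (rule coset_coboundaries_nontrivial[where C = ?X and d = ?dX, OF dn.group_hom_axioms zX dz])
      (use \<phi>z zX in \<open>simp add: compose_def\<close>)
  \<comment> \<open>With only the trivial coboundary in the target, the class of
    \<open>\<phi>\<close> is a singleton, and the \<open>the_elem\<close> in the map on cohomology
    is evaluated directly.\<close>
  have CY: "?CY = {\<one>\<^bsub>cochain_group ?Y n\<^esub>}"
    using coboundary_T_infinity[of _ "n - 1"] zero_cochain[of ?Y "n - 1", OF group_quandle_chains]
    by (force simp: image_iff)
  have "\<one>\<^bsub>cochain_group ?Y n\<^esub> \<otimes>\<^bsub>cochain_group ?Y n\<^esub> \<phi> = \<phi>"
    using \<phi>(1) by (auto simp: cochain_group_def Hom_group_def extensional_def)
  then have \<phi>_class: "?CY #>\<^bsub>cochain_group ?Y n\<^esub> \<phi> = {\<phi>}"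
    by (simp add: CY r_coset_def)
  then have "{\<phi>} \<in> carrier (quandle_cohomology n T_infinity)"
    using \<phi>(1) coboundary_T_infinity[OF \<phi>(1)]
    by (auto simp: quandle_cohomology_def cohomology_group_def carrier_FactGroup kernel_def)
  moreover have "quandle_cohomology_map n Q T_infinity f {\<phi>} = ?CX #>\<^bsub>cochain_group ?X n\<^esub> ?\<psi>"
    by (simp add: quandle_cohomology_map_def cohomology_map_def)
  ultimately show "\<exists>v \<in> carrier (quandle_cohomology n T_infinity).
      quandle_cohomology_map n Q T_infinity f v \<in> carrier (quandle_cohomology n Q) \<and>
      quandle_cohomology_map n Q T_infinity f v \<noteq> \<one>\<^bsub>quandle_cohomology n Q\<^esub>"
    using \<psi>_class \<psi>_nontrivial
    by (metis cohomology_group_def one_FactGroup quandle_cohomology_def)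
qed

section \<open>The Alexander quandle\<close>

lemma carrier_alexander_quandle_of:
  "carrier (alexander_quandle_of h) = range ((+>\<^bsub>laurent_ring\<^esub>) (poly_ideal h))"
  by (auto simp: alexander_quandle_of_def alexander_quandle_def FactRing_def A_RCOSETS_def')

text \<open>The coset map is a ring homomorphism, so the operation can be computed on Laurent
  representatives.\<close>

lemma alexander_quandle_of_qop:
  "(poly_ideal h +>\<^bsub>laurent_ring\<^esub> x) \<triangleright>\<^bsub>alexander_quandle_of h\<^esub> (poly_ideal h +>\<^bsub>laurent_ring\<^esub> y) =
    poly_ideal h +>\<^bsub>laurent_ring\<^esub> (laurent_T * x + (1 - laurent_T) * y)"
proof -
  let ?q = "(+>\<^bsub>laurent_ring\<^esub>) (poly_ideal h)" and ?S = "laurent_ring Quot poly_ideal h"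
  interpret ring_hom_ring laurent_ring ?S ?q
    by (rule ideal.rcos_ring_hom_ring[OF ideal_poly_ideal])
  have "?q (1 - laurent_T) = \<one>\<^bsub>?S\<^esub> \<ominus>\<^bsub>?S\<^esub> ?q laurent_T"
    using hom_add[of 1 "- laurent_T"] hom_a_inv[of laurent_T] hom_one
    by (simp add: a_minus_def)
  then show ?thesis
    using hom_mult[of laurent_T x] hom_mult[of "1 - laurent_T" y]
      hom_add[of "laurent_T * x" "(1 - laurent_T) * y"]
    by (simp add: alexander_quandle_of_def alexander_quandle_def)
qed

text \<open>The first pair leads from 0 to 0 * 1 = 1 - T. The second leads back: (1 - T) * b = T (1
  - T) + (1 - T) b vanishes at b = -T, already before dividing by \<open>h\<close>.\<close>

definition alexander_cycle :: "int poly \<Rightarrow> laurent set list \<Rightarrow>\<^sub>0 int"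
  where "alexander_cycle h =
    frag_of (map ((+>\<^bsub>laurent_ring\<^esub>) (poly_ideal h)) [0, 1])
    + frag_of (map ((+>\<^bsub>laurent_ring\<^esub>) (poly_ideal h)) [1 - laurent_T, - laurent_T])"

lemma alexander_cycle_carrier:
  "alexander_cycle h \<in> carrier (rack_chains (alexander_quandle_of h) 2)"
proof -
  have "Poly_Mapping.keys (alexander_cycle h) \<subseteq> tuples (alexander_quandle_of h) 2"
    unfolding alexander_cycle_def
    by (rule order_trans[OF Poly_Mapping.keys_add])
      (simp add: keys_frag_of tuples_def carrier_alexander_quandle_of)
  then show ?thesis by (simp add: rack_chains_def)
qed

text \<open>In degree 2 the boundary of (x, y) is (x) - (x * y), so the total is (0) - (1 - T) + (1
  - T) - (0).\<close>

lemma rack_boundary_alexander_cycle: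
  "rack_boundary (alexander_quandle_of h) (alexander_cycle h) = 0"
  by (simp add: alexander_cycle_def rack_boundary_def frag_extend_add alexander_quandle_of_qop
      algebra_simps)

text \<open>Since h(1) = 0, evaluation is constant on cosets; it sends 1 - T to 0 and -T to
  -1.\<close>

lemma rack_chain_map_alexander_cycle:
  assumes "poly h 1 = 0"
  shows "frag_extend (\<lambda>xs. frag_of (map eval_one xs)) (alexander_cycle h) =
    frag_of [0, 1] + frag_of [0, -1]"
  using laurent_at_one_minus[of 0 laurent_T]
  by (simp add: alexander_cycle_def frag_extend_add eval_one_coset[OF assms])

theorem theorem8p2:
  fixes h :: "int poly"
  assumes "poly h 1 = 0"
  shows "(\<not> (\<forall>u \<in> carrier (quandle_homology 2 (alexander_quandle_of h)).
             quandle_homology_map 2 (alexander_quandle_of h) T_infinity eval_one u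
               = \<one>\<^bsub>quandle_homology 2 T_infinity\<^esub>))
      \<and> (\<not> (\<forall>u \<in> carrier (quandle_cohomology 2 T_infinity).
             quandle_cohomology_map 2 (alexander_quandle_of h) T_infinity eval_one u
               = \<one>\<^bsub>quandle_cohomology 2 (alexander_quandle_of h)\<^esub>))
      \<and> (carrier (quandle_homology 2 (alexander_quandle_of h))
           \<noteq> {\<one>\<^bsub>quandle_homology 2 (alexander_quandle_of h)\<^esub>})
      \<and> (carrier (quandle_cohomology 2 (alexander_quandle_of h))
           \<noteq> {\<one>\<^bsub>quandle_cohomology 2 (alexander_quandle_of h)\<^esub>})"
proof -
  \<comment> \<open>The tuple \<open>[0, -1]\<close> contributes nothing to the coefficient of
    \<open>[0, 1]\<close>, which is therefore 1.\<close>
  have "Poly_Mapping.lookup (frag_extend (\<lambda>xs. frag_of (map eval_one xs)) (alexander_cycle h)) [0, 1]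
      \<noteq> 0"
    by (simp add: rack_chain_map_alexander_cycle[OF assms] lookup_add)
  moreover have "[0, 1] \<in> tuples T_infinity 2"
    by (simp add: tuples_def T_infinity_def)
  moreover have "[0, 1 :: int] ! j \<noteq> [0, 1] ! Suc j" if "Suc j < length [0, 1 :: int]" for j
    using that by (cases j) auto
  \<comment> \<open>The same witnesses settle the last two conjuncts: the homology class is itself
    not the unit, and the pulled back class lies in the cohomology of the Alexander quandle.\<close>
  ultimately show ?thesis
    using quandle_maps_to_T_infinity_nontrivial[OF quandle_alexander_quandle_of
        eval_one_quandle_hom[OF assms] alexander_cycle_carrier rack_boundary_alexander_cycle,
        of "[0, 1]"]
    by blast
qed

end
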